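(* Let $A$ be a commutative Banach algebra, let $\phi\in\Delta(A)$ and let $E$ be a Banach left $A$-module. Let $E^{\perp}=\{a\in A : a\cdot x=0 \text{ for all } x\in E\}$. If $E^{\perp}\cap (A\setminus\ker\phi)\neq\emptyset$, then $E$ is $\phi$-injective as a Banach left $A$-module.
   Context: $\Delta(A)$ is the set of characters of the Banach algebra $A$, i.e. non-zero (algebra) homomorphisms $A\to\mathbb{C}$. For Banach left $A$-modules $F,K$, $_{A}B(F,K)$ is the space of bounded linear left $A$-module morphisms $F\to K$. A bounded linear operator $T:F\to K$ is admissible if $\ker T$ and $\operatorname{Im}T$ are closed complemented subspaces of $F$ and $K$ respectively (equivalently, there is a bounded linear $S:K\to F$ with $T\circ S\circ T=T$). A monomorphism is an injective bounded module morphism. For a Banach left $A$-module $K$ and $\phi\in\Delta(A)$, $I(\phi,K)=\operatorname{span}\{a\cdot x-\phi(a)x : a\in A,\ x\in K\}$. A Banach left $A$-module $E$ is $\phi$-injective if for all Banach left $A$-modules $F,K$ and every admissible monomorphism $T\in{}_{A}B(F,K)$ with $I(\phi,K)\subseteq\operatorname{Im}T$, the map $_{A}B(K,E)\to{}_{A}B(F,E)$, $R\mapsto R\circ T$, is onto. *)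

theory Defs
  imports "HOL-Analysis.Analysis"
begin

text \<open>
  The distribution only provides real normed spaces, so complex scalars are added on top of the
  real type classes; the norm and the completeness are those of the underlying real Banach space.
\<close>

class complex_vector = real_vector +
  fixes scaleC :: "complex \<Rightarrow> 'a \<Rightarrow> 'a"  (infixr \<open>*\<^sub>C\<close> 75)
  assumes scaleR_scaleC: "r *\<^sub>R x = complex_of_real r *\<^sub>C x"
    and scaleC_add_right: "c *\<^sub>C (x + y) = c *\<^sub>C x + c *\<^sub>C y"
    and scaleC_add_left: "(c + d) *\<^sub>C x = c *\<^sub>C x + d *\<^sub>C x"
    and scaleC_scaleC: "c *\<^sub>C d *\<^sub>C x = (c * d) *\<^sub>C x"
    and scaleC_one: "1 *\<^sub>C x = x"

class complex_normed_vector = complex_vector + real_normed_vector +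
  assumes norm_scaleC: "norm (c *\<^sub>C x) = cmod c * norm x"

class complex_banach = complex_normed_vector + banach

text \<open>As in \<^class>\<open>real_normed_algebra\<close>, no unit is required.\<close>

class complex_banach_algebra = complex_banach + real_normed_algebra +
  assumes mult_scaleC_left: "(c *\<^sub>C x) * y = c *\<^sub>C (x * y)"
    and mult_scaleC_right: "x * (c *\<^sub>C y) = c *\<^sub>C (x * y)"

instantiation complex :: complex_banach_algebra
begin

definition scaleC_complex :: "complex \<Rightarrow> complex \<Rightarrow> complex"
  where "scaleC_complex c x = c * x"

instance
  by standard (simp_all add: scaleC_complex_def scaleR_conv_of_real algebra_simps norm_mult)

end

global_interpretation complex_vector: vector_space "scaleC :: complex \<Rightarrow> 'a \<Rightarrow> 'a::complex_vector"
  by standard (simp_all add: scaleC_add_right scaleC_add_left scaleC_scaleC scaleC_one)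

abbreviation clinear :: "('a::complex_vector \<Rightarrow> 'b::complex_vector) \<Rightarrow> bool"
  where "clinear \<equiv> Vector_Spaces.linear scaleC scaleC"

definition bounded_clinear :: "('a::complex_normed_vector \<Rightarrow> 'b::complex_normed_vector) \<Rightarrow> bool"
  where "bounded_clinear T \<longleftrightarrow> clinear T \<and> (\<exists>C. \<forall>x. norm (T x) \<le> C * norm x)"

definition closed_complemented :: "'a::complex_normed_vector set \<Rightarrow> bool"
  where "closed_complemented M \<longleftrightarrow>
    complex_vector.subspace M \<and> closed M \<and>
    (\<exists>N. complex_vector.subspace N \<and> closed N \<and> M \<inter> N = {0} \<and>
         {m + n | m n. m \<in> M \<and> n \<in> N} = UNIV)"

definition admissible :: "('f::complex_normed_vector \<Rightarrow> 'k::complex_normed_vector) \<Rightarrow> bool"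
  where "admissible T \<longleftrightarrow> closed_complemented {x. T x = 0} \<and> closed_complemented (range T)"

definition character :: "('a::complex_banach_algebra \<Rightarrow> complex) \<Rightarrow> bool"
  where "character \<phi> \<longleftrightarrow> clinear \<phi> \<and> (\<forall>a b. \<phi> (a * b) = \<phi> a * \<phi> b) \<and> (\<exists>a. \<phi> a \<noteq> 0)"

text \<open>
  A Banach left module over \<^typ>\<open>'a\<close> is a complex Banach space \<^typ>\<open>'e\<close> with a bounded bilinear
  action; the action is not required to be contractive.
\<close>

definition banach_left_module ::
    "('a::complex_banach_algebra \<Rightarrow> 'e::complex_banach \<Rightarrow> 'e) \<Rightarrow> bool"
  where "banach_left_module act \<longleftrightarrow>
    (\<forall>x. clinear (\<lambda>a. act a x)) \<and> (\<forall>a. clinear (act a)) \<and>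
    (\<forall>a b x. act (a * b) x = act a (act b x)) \<and>
    (\<exists>C. \<forall>a x. norm (act a x) \<le> C * norm a * norm x)"

definition module_morphisms ::
    "('a \<Rightarrow> 'f \<Rightarrow> 'f) \<Rightarrow> ('a \<Rightarrow> 'k \<Rightarrow> 'k) \<Rightarrow>
     ('f::complex_banach \<Rightarrow> 'k::complex_banach) set"
  where "module_morphisms actF actK =
    {T. bounded_clinear T \<and> (\<forall>a x. T (actF a x) = actK a (T x))}"

definition I_space :: "('a \<Rightarrow> complex) \<Rightarrow> ('a \<Rightarrow> 'k \<Rightarrow> 'k) \<Rightarrow> 'k::complex_banach set"
  where "I_space \<phi> act = complex_vector.span {act a x - \<phi> a *\<^sub>C x | a x. True}"

definition annihilator :: "('a \<Rightarrow> 'e::zero \<Rightarrow> 'e) \<Rightarrow> 'a set"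
  where "annihilator act = {a. \<forall>x. act a x = 0}"

text \<open>
  HOL cannot quantify over types inside a definition, so the underlying Banach spaces of the test
  modules \<open>F\<close> and \<open>K\<close> are the two type arguments. Being \<open>\<phi>\<close>-injective means that this
  predicate holds for all types \<^typ>\<open>'f\<close> and \<^typ>\<open>'k\<close> of class \<^class>\<open>complex_banach\<close>; a theorem
  concluding it with \<^typ>\<open>'f\<close> and \<^typ>\<open>'k\<close> as type variables asserts exactly that.
\<close>

definition phi_injective ::
    "'f::complex_banach itself \<Rightarrow> 'k::complex_banach itself \<Rightarrow>
     ('a::complex_banach_algebra \<Rightarrow> complex) \<Rightarrow> ('a \<Rightarrow> 'e::complex_banach \<Rightarrow> 'e) \<Rightarrow> bool"
  where "phi_injective _ _ \<phi> actE \<longleftrightarrow>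
    (\<forall>(actF :: 'a \<Rightarrow> 'f \<Rightarrow> 'f) (actK :: 'a \<Rightarrow> 'k \<Rightarrow> 'k).
      banach_left_module actF \<longrightarrow> banach_left_module actK \<longrightarrow>
      (\<forall>T \<in> module_morphisms actF actK.
        inj T \<longrightarrow> admissible T \<longrightarrow> I_space \<phi> actK \<subseteq> range T \<longrightarrow>
        (\<lambda>R. R \<circ> T) ` module_morphisms actK actE = module_morphisms actF actE))"

end

(* After rescaling, some a0 with \<phi> a0 = 1 annihilates E.  For an admissible monomorphism T the
   hypothesis on I(\<phi>, K) puts every k - a0 k into the range of T, so S k = T^-1 (k - a0 k) is
   defined on all of K.  It is a module morphism because A is commutative, it is bounded by the
   closed graph theorem, and S (T x) = x - a0 x.  Hence R \<circ> S extends R: the correction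
   R (a0 x) = a0 (R x) vanishes in E. *)

theory Submission
  imports Defs
begin

text \<open>By Baire, some sublevel set of \<open>norm (S x)\<close> is dense in a ball. Recentring
  and rescaling then approximate any x up to half its norm by a vector whose image is at most a
  constant times \<open>norm x\<close>. Iterating on the error writes x as a series whose images
  converge absolutely; closedness of the graph identifies the sum of the images with
  \<open>S x\<close>.\<close>

theorem closed_graph:
  fixes S :: "'a::banach \<Rightarrow> 'b::banach"
  assumes lin: "linear S" and graph: "closed (range (\<lambda>x. (x, S x)))"
  shows "bounded_linear S"
proof -
  define A where "A n = closure {x. norm (S x) \<le> real n}" for n :: nat
  have "x \<in> A (nat \<lceil>norm (S x)\<rceil>)" for x
    unfolding A_def by (rule closure_subset[THEN subsetD]) (simp add: real_nat_ceiling_ge)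
  then have cover: "\<Union>(range A) = UNIV"
    by blast
  \<comment> \<open>Otherwise a countable union of closed sets with empty interior would have empty
    interior, although the union is the whole space.\<close>
  have "\<exists>n. interior (A n) \<noteq> {}"
  proof (rule ccontr)
    assume "\<not> ?thesis"
    then have "euclidean interior_of \<Union>(range A) = {}"
      by (intro Baire_category_alt disjI1 completely_metrizable_space_euclidean)
        (auto simp: A_def closed_closedin[symmetric])
    then show False
      using cover by simp
  qed
  then obtain n c where "c \<in> interior (A n)"
    by blast
  then obtain r where r: "r > 0" "ball c r \<subseteq> A n"
    by (meson mem_interior)
  \<comment> \<open>Moves the ball from c to 0: subtract an approximation of c from one of c + y.
    Each has an image of norm at most n, hence the factor 2.\<close>
  have near: "\<exists>v. norm (y - v) < e \<and> norm (S v) \<le> 2 * real n" if "norm y < r" "e > 0" for y e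
  proof -
    have "c + y \<in> A n" "c \<in> A n"
      using r that by (auto simp: dist_norm)
    then obtain p q where p: "norm (S p) \<le> n" "dist p (c + y) < e / 2"
      and q: "norm (S q) \<le> n" "dist q c < e / 2"
      unfolding A_def closure_approachable using \<open>e > 0\<close> half_gt_zero by blast
    have "y - (p - q) = (q - c) - (p - (c + y))"
      by simp
    then have "norm (y - (p - q)) \<le> norm (q - c) + norm (p - (c + y))"
      by (metis norm_triangle_ineq4)
    moreover have "norm (S (p - q)) \<le> norm (S p) + norm (S q)"
      by (simp add: linear_diff[OF lin] norm_triangle_ineq4)
    ultimately show ?thesis
      using p q by (intro exI[of _ "p - q"]) (auto simp: dist_norm)
  qed
  \<comment> \<open>Dividing x by t = 2 * norm x / r gives a vector of norm r / 2, inside the ball.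
    Scaling back turns the error r / 4 into norm x / 2 and the bound 2 * n into M * norm x.\<close>
  define M where "M = 4 * real n / r"
  have "M \<ge> 0"
    using r by (simp add: M_def)
  have half: "\<exists>v. norm (x - v) \<le> norm x / 2 \<and> norm (S v) \<le> M * norm x" for x
  proof (cases "x = 0")
    case True
    then show ?thesis
      by (intro exI[of _ 0]) (simp add: linear_0[OF lin])
  next
    case False
    define t where "t = 2 * norm x / r"
    have t: "t > 0"
      using False r by (simp add: t_def)
    have "norm (x /\<^sub>R t) < r"
      using False r by (simp add: t_def field_simps)
    moreover have "r / 4 > 0"
      using r by simp
    ultimately obtain v where v: "norm (x /\<^sub>R t - v) < r / 4" "norm (S v) \<le> 2 * real n"
      using near[of "x /\<^sub>R t" "r / 4"] by metis
    have "x - t *\<^sub>R v = t *\<^sub>R (x /\<^sub>R t - v)"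
      using t by (simp add: scaleR_diff_right)
    then have "norm (x - t *\<^sub>R v) = t * norm (x /\<^sub>R t - v)"
      using t by simp
    also have "\<dots> \<le> t * (r / 4)"
      using v t by (intro mult_left_mono) auto
    also have "\<dots> = norm x / 2"
      using r by (simp add: t_def)
    finally have 1: "norm (x - t *\<^sub>R v) \<le> norm x / 2" .
    have "norm (S (t *\<^sub>R v)) = t * norm (S v)"
      using t by (simp add: linear_scale[OF lin])
    also have "\<dots> \<le> t * (2 * real n)"
      using v t by (intro mult_left_mono) auto
    also have "\<dots> = M * norm x"
      by (simp add: t_def M_def)
    finally show ?thesis
      using 1 by blast
  qed
  then obtain g where g: "norm (x - g x) \<le> norm x / 2" "norm (S (g x)) \<le> M * norm x" for x
    by metis
  have bound: "norm (S x) \<le> norm x * (2 * M)" for x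
  proof -
    \<comment> \<open>\<open>X k\<close> is the error left after k approximations. It at least
      halves in norm each time, so the corrections \<open>g (X k)\<close> telescope to x.\<close>
    define X where "X k = ((\<lambda>y. y - g y) ^^ k) x" for k
    have X_Suc: "X (Suc k) = X k - g (X k)" and X_0: "X 0 = x" for k
      by (simp_all add: X_def)
    have X_le: "norm (X k) \<le> norm x * (1 / 2) ^ k" for k
    proof (induction k)
      case (Suc k)
      then show ?case
        using g(1)[of "X k"] by (simp add: X_Suc)
    qed (simp add: X_0)
    have geo: "(\<lambda>k. (1 / 2 :: real) ^ k) sums 2"
      using geometric_sums[of "1 / 2 :: real"] by simp
    have "(\<lambda>k. norm x * (1 / 2) ^ k) \<longlonglongrightarrow> norm x * 0"
      by (intro tendsto_intros LIMSEQ_power_zero) simp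
    then have "X \<longlonglongrightarrow> 0"
      by (intro Lim_null_comparison[of X "\<lambda>k. norm x * (1 / 2) ^ k"]) (auto simp: X_le)
    from telescope_sums'[OF this] have sum_g: "(\<lambda>k. g (X k)) sums x"
      by (simp add: X_Suc X_0)
    \<comment> \<open>Summable majorant of the norms of the images; its sum is the final bound on
      \<open>norm (S x)\<close>.\<close>
    define b where "b k = M * (norm x * (1 / 2) ^ k)" for k :: nat
    have b: "b sums (M * (norm x * 2))"
      unfolding b_def by (intro sums_mult geo)
    have Sb: "norm (S (g (X k))) \<le> b k" for k
      unfolding b_def using g(2)[of "X k"] mult_left_mono[OF X_le \<open>M \<ge> 0\<close>] by (rule order_trans)
    have sn: "summable (\<lambda>k. norm (S (g (X k))))"
      by (rule summable_comparison_test'[OF sums_summable[OF b]]) (simp add: Sb)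
    define z where "z = (\<Sum>k. S (g (X k)))"
    have Sz: "(\<lambda>k. S (g (X k))) sums z"
      unfolding z_def by (rule summable_sums[OF summable_norm_cancel[OF sn]])
    \<comment> \<open>The partial sums are points of the graph that converge in both coordinates, so
      the limit lies on the graph as well.\<close>
    have "(\<lambda>m. (\<Sum>k<m. g (X k), S (\<Sum>k<m. g (X k)))) \<longlonglongrightarrow> (x, z)"
      unfolding linear_sum[OF lin] using sum_g Sz by (auto intro: tendsto_Pair simp only: sums_def)
    then have "(x, z) \<in> range (\<lambda>x. (x, S x))"
      by (rule closed_sequentially[OF graph rangeI])
    then have "S x = z"
      by auto
    moreover have "norm z \<le> (\<Sum>k. norm (S (g (X k))))"
      unfolding z_def by (rule summable_norm[OF sn])
    moreover have "\<dots> \<le> M * (norm x * 2)"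
      using suminf_le[OF Sb sn sums_summable[OF b]] sums_unique[OF b] by simp
    ultimately show ?thesis
      by (simp add: mult_ac)
  qed
  show ?thesis
    using lin bound by (intro bounded_linear_intro[of S "2 * M"]) (auto simp: linear_add linear_scale)
qed

lemma clinear_iff:
  "clinear f \<longleftrightarrow> (\<forall>x y. f (x + y) = f x + f y) \<and> (\<forall>c x. f (c *\<^sub>C x) = c *\<^sub>C f x)"
  by (auto simp: Vector_Spaces.linear_iff complex_vector.vector_space_axioms)

lemma clinear_imp_linear: "clinear f \<Longrightarrow> linear f"
  by (intro linearI) (auto simp: clinear_iff scaleR_scaleC)

text \<open>Makes the real theory of \<open>bounded_linear\<close>, including the closed graph
  theorem above, available for complex-linear maps.\<close>

lemma bounded_clinear_iff: "bounded_clinear f \<longleftrightarrow> clinear f \<and> bounded_linear f"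
proof
  assume f: "bounded_clinear f"
  then obtain C where "\<forall>x. norm (f x) \<le> C * norm x"
    by (auto simp: bounded_clinear_def)
  then show "clinear f \<and> bounded_linear f"
    using f clinear_imp_linear[of f]
    by (auto simp: bounded_clinear_def linear_add linear_scale mult.commute
        intro!: bounded_linear_intro[of f C])
next
  assume f: "clinear f \<and> bounded_linear f"
  then obtain C where "\<forall>x. norm (f x) \<le> norm x * C"
    using bounded_linear.bounded by blast
  with f show "bounded_clinear f"
    by (auto simp: bounded_clinear_def mult.commute)
qed

lemma module_morphisms_compose:
  assumes "R \<in> module_morphisms actK actE" "T \<in> module_morphisms actF actK"
  shows "R \<circ> T \<in> module_morphisms actF actE"
  using assms
  by (auto simp: module_morphisms_def bounded_clinear_iff clinear_iff bounded_linear_compose o_def)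

lemma banach_left_module_bounded_clinear:
  assumes "banach_left_module act"
  shows "bounded_clinear (act a)"
  using assms unfolding banach_left_module_def bounded_clinear_def by blast

theorem theorem2p3:
  fixes \<phi> :: "'a::{complex_banach_algebra, comm_ring} \<Rightarrow> complex"
    and act :: "'a \<Rightarrow> 'e::complex_banach \<Rightarrow> 'e"
  assumes "character \<phi>"
    and "banach_left_module act"
    and "annihilator act \<inter> (UNIV - {a. \<phi> a = 0}) \<noteq> {}"
  shows "phi_injective TYPE('f::complex_banach) TYPE('k::complex_banach) \<phi> act"
proof -
  obtain a1 where a1: "\<And>x. act a1 x = 0" "\<phi> a1 \<noteq> 0"
    using assms(3) by (auto simp: annihilator_def)
  \<comment> \<open>Normalised so that \<open>actK a0 k - k\<close> is one of the generators of
    \<open>I_space \<phi> actK\<close>; a scalar multiple of \<open>a1\<close> still annihilates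
    E.\<close>
  define a0 where "a0 = inverse (\<phi> a1) *\<^sub>C a1"
  have phi_a0: "\<phi> a0 = 1"
    using assms(1) a1 by (simp add: a0_def character_def clinear_iff scaleC_complex_def)
  have ann: "act a0 x = 0" for x
    using assms(2) a1
    by (simp add: a0_def banach_left_module_def clinear_iff complex_vector.scale_zero_right)
  show ?thesis
    unfolding phi_injective_def
  proof (intro allI impI ballI)
    fix actF :: "'a \<Rightarrow> 'f \<Rightarrow> 'f" and actK :: "'a \<Rightarrow> 'k \<Rightarrow> 'k" and T
    assume K: "banach_left_module actK"
      and T: "T \<in> module_morphisms actF actK" and "inj T"
      and I: "I_space \<phi> actK \<subseteq> range T"
    have Tc: "clinear T" and Tb: "bounded_linear T" and TA: "T (actF a x) = actK a (T x)" for a x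
      using T by (auto simp: module_morphisms_def bounded_clinear_iff)
    have Kc: "clinear (actK a)" and Kb: "bounded_linear (actK a)" for a
      using banach_left_module_bounded_clinear[OF K] by (auto simp: bounded_clinear_iff)
    \<comment> \<open>Commutativity of A enters here; it will make S commute with the
      action.\<close>
    have K_comm: "actK a0 (actK a k) = actK a (actK a0 k)" for a k
      using K by (metis banach_left_module_def mult.commute)
    have "k - actK a0 k \<in> range T" for k
    proof -
      have "actK a0 k - k \<in> I_space \<phi> actK"
        unfolding I_space_def by (rule complex_vector.span_base)
          (intro CollectI exI[of _ a0] exI[of _ k], simp add: phi_a0 scaleC_one)
      then obtain x where "actK a0 k - k = T x"
        using I by blast
      then have "k - actK a0 k = T (- x)"
        by (metis Tb bounded_linear.linear linear_neg minus_diff_eq)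
      then show ?thesis
        by simp
    qed
    then have "\<forall>k. \<exists>x. T x = k - actK a0 k"
      by (metis rangeE)
    then obtain S where TS: "T (S k) = k - actK a0 k" for k
      by metis
    \<comment> \<open>As T is injective, identities for S can be checked after applying T.\<close>
    have S_eqI: "S k = x" if "T x = k - actK a0 k" for k x
      using that TS \<open>inj T\<close> by (metis injD)
    have Sc: "clinear S"
      unfolding clinear_iff
      using Tc Kc
      by (auto intro!: S_eqI simp: TS clinear_iff complex_vector.scale_right_diff_distrib)
    \<comment> \<open>The graph becomes the solution set of an equation between continuous maps in
      which S no longer occurs, so it is closed.\<close>
    have "range (\<lambda>k. (k, S k)) = {p. T (snd p) = fst p - actK a0 (fst p)}"
      using TS S_eqI by force
    moreover have "closed \<dots>"
      by (intro closed_Collect_eq continuous_intros bounded_linear.continuous_on[OF Tb]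
          bounded_linear.continuous_on[OF Kb])
    ultimately have "bounded_linear S"
      by (intro closed_graph clinear_imp_linear Sc) simp
    moreover have "S (actK a k) = actF a (S k)" for a k
    proof (rule S_eqI)
      have "T (actF a (S k)) = actK a (k - actK a0 k)"
        by (simp add: TA TS)
      also have "\<dots> = actK a k - actK a0 (actK a k)"
        by (simp add: linear_diff[OF bounded_linear.linear[OF Kb]] K_comm)
      finally show "T (actF a (S k)) = actK a k - actK a0 (actK a k)" .
    qed
    ultimately have S: "S \<in> module_morphisms actK actF"
      using Sc by (simp add: module_morphisms_def bounded_clinear_iff)
    have ST: "S (T x) = x - actF a0 x" for x
      by (rule S_eqI) (simp add: linear_diff[OF bounded_linear.linear[OF Tb]] TA)
    show "(\<lambda>R. R \<circ> T) ` module_morphisms actK act = module_morphisms actF act"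
    proof (intro equalityI subsetI)
      fix Q
      assume "Q \<in> (\<lambda>R. R \<circ> T) ` module_morphisms actK act"
      then show "Q \<in> module_morphisms actF act"
        using T by (auto intro: module_morphisms_compose)
    next
      fix R
      assume R: "R \<in> module_morphisms actF act"
      then have "linear R" and RA: "R (actF a x) = act a (R x)" for a x
        by (auto simp: module_morphisms_def bounded_clinear_iff bounded_linear.linear)
      then have "R = (R \<circ> S) \<circ> T"
        by (auto simp: ST linear_diff ann)
      moreover have "R \<circ> S \<in> module_morphisms actK act"
        using R S by (rule module_morphisms_compose)
      ultimately show "R \<in> (\<lambda>R. R \<circ> T) ` module_morphisms actK act"
        by blast
    qed
  qed
qed

end
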